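(* Let $n_0\ge 1$ be an integer, and let $f:[n_0,\infty)\to\mathbb{R}$, together with $R,S,m,M$, be as in the context. Let $n\ge n_0+1$ be an integer, suppose that $f$ is increasing (non-decreasing) on $[n_0,n]$, and let $x\in(n,n+1)$. If $R'(x)\ge 0$, $R'(x)\,m(x-1)+S'(x)\ge 0$ and $S(x)\le 0$, then $f'(x)\ge 0$.
   Context: Setting: $R$ and $S$ are real functions that are smooth on all open intervals $(k,k+1)$ for integers $k\ge n_0$. The function $f:[n_0,\infty)\to\mathbb{R}$ is continuous, is an affine linear function on $[n_0,n_0+1]$, and satisfies $$f(x)=R(x)+\frac{S(x)}{f(x-1)}\quad\text{for all } x\ge n_0+1.$$ There are functions $m,M$ on $[n_0,\infty)$ with $0<m(x)\le f(x)\le M(x)$ for all $x\ge n_0$. *)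

theory Defs
  imports "HOL-Analysis.Analysis"
begin

(* C-infinity on an open set A: on open sets the iterated deriv only depends on
   the values on A, so requiring every iterate to be differentiable at every
   point of A is existence of derivatives of all orders. Meant for open A only. *)
definition smooth_on_open :: "real set \<Rightarrow> (real \<Rightarrow> real) \<Rightarrow> bool" where
  "smooth_on_open A g \<longleftrightarrow> (\<forall>j. \<forall>x\<in>A. (deriv ^^ j) g differentiable (at x))"

definition affine_linear_on :: "real set \<Rightarrow> (real \<Rightarrow> real) \<Rightarrow> bool" where
  "affine_linear_on A g \<longleftrightarrow> (\<exists>a b. \<forall>x\<in>A. g x = a * x + b)"

end

theory Submission
  imports Defs
begin

text \<open>On \<open>(n, n + 1)\<close> the recursion expresses \<open>f\<close> through its values on \<open>(n - 1, n)\<close>, so smoothness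
  propagates from unit interval to unit interval, starting with the affine piece. Differentiating,
  \<open>f'(x) = (R'(x) f(x-1) + S'(x)) / f(x-1) - S(x) f'(x-1) / f(x-1)^2\<close>. The first numerator is at
  least \<open>R'(x) m(x-1) + S'(x) \<ge> 0\<close>, and the second term is nonnegative because \<open>S(x) \<le> 0\<close> and \<open>f\<close> is
  increasing near \<open>x - 1\<close>.\<close>

lemma smooth_on_open_imp_differentiable:
  assumes "smooth_on_open A g" "x \<in> A"
  shows "g differentiable (at x)"
  using assms unfolding smooth_on_open_def by (metis funpow_0)

text \<open>Quotient rule for the right-hand side of the recursion. Derivatives are local, so the
  recursion is required only near \<open>x\<close>. The lemma yields existence as well as the value
  of the derivative, so it serves both the induction over unit intervals and the final sign
  computation.\<close>

lemma has_real_derivative_shifted_quotient: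
  fixes R S f :: "real \<Rightarrow> real"
  assumes rec: "\<forall>\<^sub>F y in nhds x. f y = R y + S y / f (y - 1)"
    and R: "(R has_real_derivative R') (at x)"
    and S: "(S has_real_derivative S') (at x)"
    and f: "(f has_real_derivative f') (at (x - 1))"
    and nz: "f (x - 1) \<noteq> 0"
  shows "(f has_real_derivative R' + (S' * f (x - 1) - S x * f') / (f (x - 1))\<^sup>2) (at x)"
proof -
  have "((\<lambda>y. f (y - 1)) has_real_derivative f') (at x)"
    using f DERIV_shift[of f f' x "-1"] by simp
  then have "((\<lambda>y. R y + S y / f (y - 1)) has_real_derivative
      R' + (S' * f (x - 1) - S x * f') / (f (x - 1) * f (x - 1))) (at x)"
    using R S nz by (intro DERIV_add DERIV_divide)
  with rec show ?thesis
    by (simp add: DERIV_cong_ev[OF refl rec refl] power2_eq_square)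
qed

text \<open>Induction on \<open>k\<close>: the affine piece starts it, and the recursion carries
  differentiability at \<open>x - 1\<close> over to \<open>x\<close>. The intervals are open because
  \<open>f\<close> may have kinks at integers.\<close>

lemma differentiable_on_unit_intervals:
  fixes n0 k :: int and R S f :: "real \<Rightarrow> real"
  assumes R: "\<And>k::int. k \<ge> n0 \<Longrightarrow> smooth_on_open {real_of_int k<..<real_of_int k + 1} R"
    and S: "\<And>k::int. k \<ge> n0 \<Longrightarrow> smooth_on_open {real_of_int k<..<real_of_int k + 1} S"
    and affine: "affine_linear_on {real_of_int n0..real_of_int n0 + 1} f"
    and rec: "\<And>y. y \<ge> real_of_int n0 + 1 \<Longrightarrow> f y = R y + S y / f (y - 1)"
    and nz: "\<And>y. y \<ge> real_of_int n0 \<Longrightarrow> f y \<noteq> 0"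
    and "k \<ge> n0" "x \<in> {real_of_int k<..<real_of_int k + 1}"
  shows "f differentiable (at x)"
  using \<open>k \<ge> n0\<close> \<open>x \<in> _\<close>
proof (induction k arbitrary: x rule: int_ge_induct)
  case base
  from affine obtain a b where ab: "\<And>y. y \<in> {real_of_int n0..real_of_int n0 + 1} \<Longrightarrow> f y = a * y + b"
    unfolding affine_linear_on_def by blast
  have "\<forall>\<^sub>F y in nhds x. y \<in> {real_of_int n0<..<real_of_int n0 + 1}"
    using base by (intro eventually_nhds_in_open) auto
  then have "\<forall>\<^sub>F y in nhds x. f y = a * y + b"
    by eventually_elim (simp add: ab)
  moreover have "((\<lambda>y. a * y + b) has_real_derivative a) (at x)"
    by (auto intro!: derivative_eq_intros)
  ultimately have "(f has_real_derivative a) (at x)"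
    by (simp add: DERIV_cong_ev[OF refl _ refl])
  then show ?case
    using real_differentiable_def by blast
next
  case (step i)
  \<comment> \<open>Here \<open>x\<close> lies in \<open>(i + 1, i + 2)\<close>, so
    \<open>x - 1\<close> lies in the interval of the induction hypothesis.\<close>
  have "f differentiable (at (x - 1))"
    using step by simp
  moreover have "R differentiable (at x)" "S differentiable (at x)"
    using R[of "i + 1"] S[of "i + 1"] step smooth_on_open_imp_differentiable by simp_all
  moreover have "\<forall>\<^sub>F y in nhds x. y \<in> {real_of_int n0 + 1<..}"
    using step by (intro eventually_nhds_in_open) auto
  then have "\<forall>\<^sub>F y in nhds x. f y = R y + S y / f (y - 1)"
    by eventually_elim (simp add: rec)
  moreover have "f (x - 1) \<noteq> 0"
    using nz step by simp
  ultimately show ?case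
    unfolding real_differentiable_def using has_real_derivative_shifted_quotient by meson
qed

theorem theorem4p1:
  fixes n0 n :: int and R S f m M :: "real \<Rightarrow> real" and x :: real
  assumes n0: "n0 \<ge> 1"
    and R_smooth: "\<And>k::int. k \<ge> n0 \<Longrightarrow> smooth_on_open {real_of_int k<..<real_of_int k + 1} R"
    and S_smooth: "\<And>k::int. k \<ge> n0 \<Longrightarrow> smooth_on_open {real_of_int k<..<real_of_int k + 1} S"
    and f_cont: "continuous_on {real_of_int n0..} f"
    and f_affine: "affine_linear_on {real_of_int n0..real_of_int n0 + 1} f"
    and f_rec: "\<And>y. y \<ge> real_of_int n0 + 1 \<Longrightarrow> f y = R y + S y / f (y - 1)"
    and bounds: "\<And>y. y \<ge> real_of_int n0 \<Longrightarrow> 0 < m y \<and> m y \<le> f y \<and> f y \<le> M y"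
    and n: "n \<ge> n0 + 1"
    and f_mono: "mono_on {real_of_int n0..real_of_int n} f"
    and x: "x \<in> {real_of_int n<..<real_of_int n + 1}"
    and R'_nonneg: "deriv R x \<ge> 0"
    and R'S'_nonneg: "deriv R x * m (x - 1) + deriv S x \<ge> 0"
    and S_nonpos: "S x \<le> 0"
  shows "f differentiable (at x) \<and> deriv f x \<ge> 0"
proof -
  have x1: "x - 1 \<in> {real_of_int (n - 1)<..<real_of_int (n - 1) + 1}"
    using x by simp
  have fx1: "0 < f (x - 1)" "m (x - 1) \<le> f (x - 1)"
    using bounds[of "x - 1"] x n by auto
  have nz: "f y \<noteq> 0" if "y \<ge> real_of_int n0" for y
    using bounds[OF that] by linarith
  have "f differentiable (at (x - 1))"
    using n x1 by (intro differentiable_on_unit_intervals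
        [OF R_smooth S_smooth f_affine f_rec nz, of "n - 1"]) auto
  then obtain f' where f': "(f has_real_derivative f') (at (x - 1))"
    using real_differentiable_def by blast
  \<comment> \<open>Since \<open>n - 1 \<ge> n0\<close>, the point \<open>x - 1\<close> is interior
    to the range of monotonicity, which forces its two-sided derivative to be nonnegative.\<close>
  have "x - 1 \<in> interior {real_of_int n0..real_of_int n}"
    using x n by (simp add: interior_atLeastAtMost_real)
  then have f'_nonneg: "f' \<ge> 0"
    using mono_on_imp_deriv_nonneg[OF f_mono f'] by simp
  have R': "(R has_real_derivative deriv R x) (at x)"
    and S': "(S has_real_derivative deriv S x) (at x)"
    using smooth_on_open_imp_differentiable[OF R_smooth x]
      smooth_on_open_imp_differentiable[OF S_smooth x] n
    by (simp_all add: DERIV_deriv_iff_real_differentiable)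
  have "\<forall>\<^sub>F y in nhds x. y \<in> {real_of_int n0 + 1<..}"
    using x n by (intro eventually_nhds_in_open) auto
  then have "\<forall>\<^sub>F y in nhds x. f y = R y + S y / f (y - 1)"
    by eventually_elim (simp add: f_rec)
  \<comment> \<open>This also shows that \<open>deriv f x\<close> is a true derivative and not an
    unspecified value.\<close>
  then have deriv_f: "(f has_real_derivative
      deriv R x + (deriv S x * f (x - 1) - S x * f') / (f (x - 1))\<^sup>2) (at x)"
    using has_real_derivative_shifted_quotient[OF _ R' S' f'] fx1 by simp
  \<comment> \<open>The sign of \<open>deriv R x\<close> allows the lower bound \<open>m\<close> to
    be replaced by \<open>f\<close> in the hypothesis.\<close>
  have "deriv R x * m (x - 1) \<le> deriv R x * f (x - 1)"
    using R'_nonneg fx1 by (intro mult_left_mono)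
  then have "0 \<le> (deriv R x * f (x - 1) + deriv S x) / f (x - 1)"
    using R'S'_nonneg fx1 by (intro divide_nonneg_pos) auto
  moreover have "0 \<le> - (S x * f') / (f (x - 1))\<^sup>2"
    using S_nonpos f'_nonneg by (simp add: mult_nonpos_nonneg divide_nonpos_nonneg)
  \<comment> \<open>Regrouping: one factor \<open>f (x - 1)\<close> cancels in the term with
    \<open>deriv S x\<close>, which then joins \<open>deriv R x\<close> over a common
    denominator.\<close>
  moreover have "deriv R x + (deriv S x * f (x - 1) - S x * f') / (f (x - 1))\<^sup>2
      = (deriv R x * f (x - 1) + deriv S x) / f (x - 1) + - (S x * f') / (f (x - 1))\<^sup>2"
    using fx1 by (simp add: field_simps power2_eq_square)
  ultimately show ?thesis
    using deriv_f DERIV_imp_deriv[OF deriv_f] real_differentiable_def by fastforce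
qed

end
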